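(* Let $(p_n)_{n=1}^\infty$ be a sequence of complex polynomials with $\deg p_1\geq 1$ and $\deg p_n\geq 2$ for $n\in\{2,3,\dots\}$. Define $\alpha:=\limsup_{n\to\infty}\frac{1}{\deg p_n}$. Assume that there exist an $r>0$ and a function $h:\mathbb{C}\to\mathbb{R}$ satisfying $h(z)-\alpha\log|z|\to\infty$ as $|z|\to\infty$ such that (i) $\bigcup_{n=1}^\infty p_n^{-1}(0)\subset\overline{\mathbb{D}}(0,r)$; (ii) for every $z\in\mathbb{C}\setminus\overline{\mathbb{D}}(0,r)$ there exist a neighbourhood $U$ of $z$ and an integer $N=N(U)>1$ such that for all $n\geq N$ and all $\zeta\in U$: $\frac{1}{\deg p_n}\log^+|p_n(\zeta)|>h(\zeta)$. Then there exists $R>0$ such that for all $n\geq 2$ and all $z\in\mathbb{C}$: if $|z|\geq R$, then $|p_n(z)|\geq e|z|$.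
   Context: Notation: $\overline{\mathbb{D}}(a,R)=\{z\in\mathbb{C}:|z-a|\leq R\}$ and $\log^+ x=\max\{0,\log x\}$ (with $\log^+0=0$); $e$ is Euler's number. *)

theory Defs
  imports "HOL-Analysis.Analysis" "HOL-Computational_Algebra.Polynomial"
begin

definition log_plus :: "real \<Rightarrow> real" where
  "log_plus x = (if x > 0 then max 0 (ln x) else 0)"

end

theory Submission
  imports Defs "HOL-Computational_Algebra.Fundamental_Theorem_Algebra"
begin

text \<open>
  It suffices to bound all but finitely many \<open>p n\<close> on a single circle \<open>\<bar>w\<bar> = \<rho>\<close> enclosing
  all the zeros, for two reasons. First, a polynomial \<open>q\<close> of degree at least two whose zeros
  lie in the disc of radius \<open>\<rho>\<close> satisfies \<open>\<bar>q (t w)\<bar> \<ge> t \<bar>q w\<bar>\<close> for \<open>\<bar>w\<bar> = \<rho>\<close> and \<open>t \<ge> 1\<close>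
  (\<open>norm_poly_scaled_ge\<close>), so that \<open>\<bar>q w\<bar> \<ge> e \<bar>w\<bar>\<close> propagates from the circle along rays
  to its whole exterior. The maximum principle for \<open>z / q z\<close> near infinity would give the same;
  the elementary argument only compares the linear factors of \<open>q\<close>. Second, each of the
  finitely many remaining polynomials grows faster than linearly on its own
  (\<open>norm_poly_superlinear\<close>), and the largest of finitely many radii can be taken.

  Choose \<open>\<rho>\<close> so large that \<open>h w \<ge> \<alpha> ln \<rho> + 1\<close> on the circle. Compactness of the circle makes
  the threshold in the lower bound uniform, so for large \<open>n\<close> and \<open>d = degree (p n)\<close> one has
  \<open>log_plus \<bar>p n w\<bar> > d (\<alpha> ln \<rho> + 1)\<close> there. What is wanted is \<open>ln \<bar>p n w\<bar> \<ge> ln \<rho> + 1\<close>, so the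
  degrees must satisfy \<open>d (\<alpha> ln \<rho> + 1) \<ge> ln \<rho> + 1\<close>. This holds eventually
  (\<open>eventually_of_limsup_inverse\<close>): if \<open>\<alpha> = 0\<close> the degrees tend to infinity, and if \<open>\<alpha> > 0\<close>
  then, degrees being integers, \<open>d \<alpha> \<ge> 1\<close> holds exactly, not just up to a small error.
\<close>

text \<open>
  The square root is what makes each of two factors contribute half of the growth \<open>t\<close>. After
  squaring, the two sides differ by \<open>(t - 1) (t \<bar>w\<bar>\<^sup>2 - \<bar>a\<bar>\<^sup>2)\<close>, the cross terms
  \<open>2 t Re (w cnj a)\<close> being the same.
\<close>

lemma norm_scaled_diff_ge:
  fixes w a :: complex
  assumes "1 \<le> t" "cmod a \<le> cmod w"
  shows "sqrt t * cmod (w - a) \<le> cmod (of_real t * w - a)"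
proof -
  have "(cmod (of_real t * w - a))\<^sup>2 - t * (cmod (w - a))\<^sup>2
      = (t - 1) * (t * (cmod w)\<^sup>2 - (cmod a)\<^sup>2)"
    unfolding cmod_power2 by (simp add: power2_eq_square algebra_simps)
  moreover have "(cmod a)\<^sup>2 \<le> t * (cmod w)\<^sup>2"
  proof -
    have "(cmod a)\<^sup>2 \<le> 1 * (cmod w)\<^sup>2"
      using assms by (simp add: power_mono)
    also have "\<dots> \<le> t * (cmod w)\<^sup>2"
      using assms by (intro mult_right_mono) auto
    finally show ?thesis .
  qed
  ultimately have "t * (cmod (w - a))\<^sup>2 \<le> (cmod (of_real t * w - a))\<^sup>2"
    using assms by (metis diff_ge_0_iff_ge mult_nonneg_nonneg)
  moreover have "(sqrt t * cmod (w - a))\<^sup>2 = t * (cmod (w - a))\<^sup>2"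
    using assms by (simp add: power_mult_distrib)
  ultimately show ?thesis
    by (metis norm_ge_zero power2_le_imp_le)
qed

text \<open>
  Split off one zero at a time and apply the preceding inequality to its linear factor.
\<close>

lemma norm_poly_scaled_ge:
  fixes q :: "complex poly"
  assumes "1 \<le> t" "\<And>a. poly q a = 0 \<Longrightarrow> cmod a \<le> cmod w"
  shows "sqrt t ^ degree q * cmod (poly q w) \<le> cmod (poly q (of_real t * w))"
  using assms(2)
proof (induction "degree q" arbitrary: q)
  case 0
  then obtain c where "q = [:c:]"
    by (metis degree_eq_zeroE)
  then show ?case by simp
next
  case (Suc k)
  have "\<not> constant (poly q)"
    using Suc.hyps(2) by (simp add: constant_degree)
  then obtain a where a: "poly q a = 0"
    using fundamental_theorem_of_algebra by blast
  then obtain s where s: "q = [:- a, 1:] * s"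
    by (meson dvdE poly_eq_0_iff_dvd)
  have "s \<noteq> 0"
    using s Suc.hyps(2) by auto
  then have deg: "degree q = Suc (degree s)"
    unfolding s by (subst degree_mult_eq) auto
  have IH: "sqrt t ^ degree s * cmod (poly s w) \<le> cmod (poly s (of_real t * w))"
    using Suc.hyps deg Suc.prems by (simp add: s)
  have "sqrt t ^ degree q * cmod (poly q w)
      = (sqrt t * cmod (w - a)) * (sqrt t ^ degree s * cmod (poly s w))"
    unfolding deg by (simp add: s norm_mult algebra_simps flip: norm_mult)
  also have "\<dots> \<le> cmod (of_real t * w - a) * cmod (poly s (of_real t * w))"
    using norm_scaled_diff_ge[OF assms(1) Suc.prems[OF a]] IH assms(1)
    by (intro mult_mono) auto
  also have "\<dots> = cmod (poly q (of_real t * w))"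
    by (simp add: s algebra_simps flip: norm_mult)
  finally show ?case .
qed

lemma norm_poly_ge_outside_circle:
  fixes q :: "complex poly"
  assumes deg: "2 \<le> degree q" and "0 < \<rho>"
    and zeros: "\<And>a. poly q a = 0 \<Longrightarrow> cmod a \<le> \<rho>"
    and circle: "\<And>w. cmod w = \<rho> \<Longrightarrow> c * \<rho> \<le> cmod (poly q w)"
    and z: "\<rho> \<le> cmod z"
  shows "c * cmod z \<le> cmod (poly q z)"
proof -
  define t where "t = cmod z / \<rho>"
  define w where "w = z / of_real t"
  have t: "1 \<le> t" and tr: "t * \<rho> = cmod z"
    using z \<open>0 < \<rho>\<close> by (auto simp: t_def field_simps)
  have w: "cmod w = \<rho>" and zw: "z = of_real t * w"
    using t tr by (auto simp: w_def norm_divide field_simps)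
  have "c * cmod z = t * (c * \<rho>)"
    by (simp flip: tr)
  also have "\<dots> \<le> t * cmod (poly q w)"
    using circle[OF w] t by simp
  also have "\<dots> \<le> sqrt t ^ degree q * cmod (poly q w)"
  proof (rule mult_right_mono)
    have "t = sqrt t ^ 2"
      using t by simp
    also have "\<dots> \<le> sqrt t ^ degree q"
      using t deg by (intro power_increasing) auto
    finally show "t \<le> sqrt t ^ degree q" .
  qed simp
  also have "\<dots> \<le> cmod (poly q z)"
    unfolding zw using norm_poly_scaled_ge[of t q w] t w zeros by blast
  finally show ?thesis .
qed

text \<open>
  Writing \<open>q z = a + z u z\<close> with \<open>u\<close> nonconstant, \<open>\<bar>u z\<bar>\<close> eventually exceeds \<open>c + \<bar>a\<bar>\<close>; for
  \<open>\<bar>z\<bar> \<ge> 1\<close> the extra \<open>\<bar>a\<bar>\<close> absorbs the constant term.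
\<close>

lemma norm_poly_superlinear:
  fixes q :: "complex poly"
  assumes "2 \<le> degree q"
  shows "eventually (\<lambda>z. c * cmod z \<le> cmod (poly q z)) at_infinity"
proof -
  obtain a b s where q: "q = pCons a (pCons b s)"
    by (metis pCons_cases)
  have "s \<noteq> 0"
    using assms by (auto simp: q split: if_splits)
  then obtain R where R: "\<And>z. R \<le> cmod z \<Longrightarrow> c + cmod a \<le> cmod (poly (pCons b s) z)"
    using poly_infinity by blast
  show ?thesis
    unfolding eventually_at_infinity
  proof (intro exI allI impI)
    fix z assume z: "max 1 R \<le> cmod z"
    have "c * cmod z \<le> (c + cmod a) * cmod z - cmod a"
      using z mult_left_mono[of 1 "cmod z" "cmod a"] by (simp add: algebra_simps)
    also have "\<dots> \<le> cmod (poly (pCons b s) z) * cmod z - cmod a"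
      using R[of z] z by (intro diff_right_mono mult_right_mono) auto
    also have "\<dots> \<le> cmod (poly q z)"
      using norm_triangle_ineq2[of "z * poly (pCons b s) z" "- a"]
      by (simp add: q norm_mult ac_simps)
    finally show "c * cmod z \<le> cmod (poly q z)" .
  qed
qed

text \<open>
  This is the step where the growth \<open>\<alpha> ln \<bar>z\<bar>\<close> of the comparison function is seen to be the
  right one. For positive \<open>\<alpha>\<close> the coefficient of \<open>L\<close> on the right must be at least \<open>1\<close>, which
  convergence up to \<open>\<epsilon>\<close> would not give.
\<close>

lemma eventually_of_limsup_inverse:
  fixes d :: "nat \<Rightarrow> nat"
  assumes alpha: "ereal \<alpha> = limsup (\<lambda>n. ereal (1 / real (d n)))"
    and pos: "eventually (\<lambda>n. 0 < d n) sequentially"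
    and "0 \<le> L"
  shows "eventually (\<lambda>n. L + 1 \<le> real (d n) * (\<alpha> * L + 1)) sequentially"
proof -
  have gt: "eventually (\<lambda>n. m < d n) sequentially" if "m = 0 \<or> \<alpha> < 1 / real m" for m
  proof (cases "m = 0")
    case False
    with that have "limsup (\<lambda>n. ereal (1 / real (d n))) < ereal (1 / real m)"
      by (simp flip: alpha)
    then have "eventually (\<lambda>n. ereal (1 / real (d n)) < ereal (1 / real m)) sequentially"
      by (rule Limsup_lessD)
    with pos show ?thesis
      by eventually_elim (use False in \<open>simp add: field_simps\<close>)
  qed (use pos in simp)
  have "0 \<le> limsup (\<lambda>n. ereal (1 / real (d n)))"
    by (rule le_Limsup) auto
  then have "0 \<le> \<alpha>"
    by (simp flip: alpha)
  then consider "\<alpha> = 0" | "0 < \<alpha>" by linarith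
  then show ?thesis
  proof cases
    case 1
    have "eventually (\<lambda>n. nat \<lceil>L + 1\<rceil> < d n) sequentially"
      by (rule gt) (use 1 \<open>0 \<le> L\<close> in auto)
    then show ?thesis
      by eventually_elim (use 1 in \<open>simp; linarith\<close>)
  next
    case 2
    \<comment> \<open>The largest integer strictly below \<open>1 / \<alpha>\<close>: exceeding it forces an integer to be at least \<open>1 / \<alpha>\<close>.\<close>
    define m where "m = nat (\<lceil>1 / \<alpha>\<rceil> - 1)"
    have "real m < 1 / \<alpha>"
      using 2 unfolding m_def by (cases "\<lceil>1 / \<alpha>\<rceil> \<ge> 1") (simp_all, linarith)
    then have "m = 0 \<or> \<alpha> < 1 / real m"
      using 2 by (cases "m = 0") (simp_all add: field_simps)
    from gt[OF this] pos show ?thesis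
    proof eventually_elim
      case (elim n)
      then have "1 / \<alpha> \<le> real (d n)"
        unfolding m_def by linarith
      then have "1 * L \<le> (real (d n) * \<alpha>) * L"
        using 2 \<open>0 \<le> L\<close> by (intro mult_right_mono) (auto simp: field_simps)
      with elim show ?case
        by (simp add: algebra_simps)
    qed
  qed
qed

lemma compact_uniformly_eventually:
  fixes P :: "nat \<Rightarrow> 'a :: topological_space \<Rightarrow> bool"
  assumes "compact K"
    and loc: "\<And>z. z \<in> K \<Longrightarrow> \<exists>U N. open U \<and> z \<in> U \<and> (\<forall>n\<ge>N. \<forall>\<zeta>\<in>U. P n \<zeta>)"
  shows "eventually (\<lambda>n. \<forall>z\<in>K. P n z) sequentially"
proof -
  obtain U N where U: "\<And>z. z \<in> K \<Longrightarrow> open (U z) \<and> z \<in> U z"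
    and N: "\<And>z. z \<in> K \<Longrightarrow> \<forall>n\<ge>N z. \<forall>\<zeta>\<in>U z. P n \<zeta>"
    using loc by metis
  obtain F where F: "F \<subseteq> K" "finite F" "K \<subseteq> (\<Union>z\<in>F. U z)"
    using compactE_image[OF assms(1), of K U] U by blast
  have "eventually (\<lambda>n. \<forall>z\<in>F. \<forall>\<zeta>\<in>U z. P n \<zeta>) sequentially"
  proof (rule eventually_ball_finite[OF \<open>finite F\<close>], rule ballI)
    fix z assume "z \<in> F"
    with F N show "eventually (\<lambda>n. \<forall>\<zeta>\<in>U z. P n \<zeta>) sequentially"
      unfolding eventually_sequentially by blast
  qed
  then show ?thesis
    by eventually_elim (use F in blast)
qed

theorem lemma2p2p3:
  fixes p :: "nat \<Rightarrow> complex poly" and \<alpha> r :: real and h :: "complex \<Rightarrow> real"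
  assumes deg1: "degree (p 1) \<ge> 1"
    and deg2: "\<And>n. n \<ge> 2 \<Longrightarrow> degree (p n) \<ge> 2"
    and alpha: "ereal \<alpha> = limsup (\<lambda>n. ereal (1 / real (degree (p n))))"
    and r_pos: "r > 0"
    and h_growth: "filterlim (\<lambda>z. h z - \<alpha> * ln (cmod z)) at_top at_infinity"
    and zeros: "(\<Union>n\<in>{1..}. poly (p n) -` {0}) \<subseteq> cball 0 r"
    and lower: "\<And>z. z \<in> - cball 0 r \<Longrightarrow>
      \<exists>U N. open U \<and> z \<in> U \<and> N > 1 \<and>
        (\<forall>n\<ge>N. \<forall>\<zeta>\<in>U. 1 / real (degree (p n)) * log_plus (cmod (poly (p n) \<zeta>)) > h \<zeta>)"
  shows "\<exists>R>0. \<forall>n\<ge>2. \<forall>z. cmod z \<ge> R \<longrightarrow> cmod (poly (p n) z) \<ge> exp 1 * cmod z"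
proof -
  have "eventually (\<lambda>z. 1 \<le> h z - \<alpha> * ln (cmod z)) at_infinity"
    using h_growth by (simp add: filterlim_at_top)
  then obtain b where b: "\<And>z. b \<le> cmod z \<Longrightarrow> 1 \<le> h z - \<alpha> * ln (cmod z)"
    by (auto simp: eventually_at_infinity)
  define \<rho> where "\<rho> = Max {b, r + 1, 1}"
  have \<rho>: "b \<le> \<rho>" "r < \<rho>" "1 \<le> \<rho>"
    by (auto simp: \<rho>_def)
  have "eventually (\<lambda>n. \<forall>w\<in>sphere 0 \<rho>.
      1 / real (degree (p n)) * log_plus (cmod (poly (p n) w)) > h w) sequentially"
  proof (rule compact_uniformly_eventually)
    fix z :: complex assume "z \<in> sphere 0 \<rho>"
    then have "z \<in> - cball 0 r"
      using \<rho> by simp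
    from lower[OF this] show "\<exists>U N. open U \<and> z \<in> U \<and> (\<forall>n\<ge>N. \<forall>\<zeta>\<in>U.
        1 / real (degree (p n)) * log_plus (cmod (poly (p n) \<zeta>)) > h \<zeta>)"
      by blast
  qed simp
  moreover have "eventually (\<lambda>n. ln \<rho> + 1 \<le> real (degree (p n)) * (\<alpha> * ln \<rho> + 1)) sequentially"
  proof (rule eventually_of_limsup_inverse[OF alpha])
    show "eventually (\<lambda>n. 0 < degree (p n)) sequentially"
      using eventually_ge_at_top[of 2] by eventually_elim (use deg2 in fastforce)
  qed (use \<rho> in simp)
  ultimately have "eventually (\<lambda>n. 2 \<le> n \<longrightarrow>
      (\<forall>z. \<rho> \<le> cmod z \<longrightarrow> exp 1 * cmod z \<le> cmod (poly (p n) z))) sequentially"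
  proof eventually_elim
    case (elim n)
    show ?case
    proof (intro impI allI)
      fix z assume n: "2 \<le> n" and z: "\<rho> \<le> cmod z"
      show "exp 1 * cmod z \<le> cmod (poly (p n) z)"
      proof (rule norm_poly_ge_outside_circle[OF deg2[OF n] _ _ _ z])
        show "cmod a \<le> \<rho>" if "poly (p n) a = 0" for a
          using zeros that n \<rho> by force
        fix w assume w: "cmod w = \<rho>"
        have d: "0 < real (degree (p n))"
          using deg2[OF n] by simp
        have "ln \<rho> + 1 \<le> real (degree (p n)) * (\<alpha> * ln \<rho> + 1)"
          by (fact elim)
        also have "\<dots> \<le> real (degree (p n)) * h w"
          using b[of w] w \<rho> by (intro mult_left_mono) auto
        also have "\<dots> < log_plus (cmod (poly (p n) w))"
          using elim(1) w d by (simp add: field_simps)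
        finally have gt: "ln \<rho> + 1 < log_plus (cmod (poly (p n) w))" .
        moreover have "0 \<le> ln \<rho>"
          using \<rho> by simp
        ultimately have pos: "0 < cmod (poly (p n) w)" and "ln \<rho> + 1 < ln (cmod (poly (p n) w))"
          by (auto simp: log_plus_def split: if_splits)
        then have "exp (ln \<rho> + 1) < exp (ln (cmod (poly (p n) w)))"
          by (simp only: exp_less_cancel_iff)
        then show "exp 1 * \<rho> \<le> cmod (poly (p n) w)"
          using pos \<rho> by (simp add: exp_add mult.commute)
      qed (use \<rho> in simp)
    qed
  qed
  then obtain N where N: "\<And>n z. N \<le> n \<Longrightarrow> 2 \<le> n \<Longrightarrow> \<rho> \<le> cmod z \<Longrightarrow>
      exp 1 * cmod z \<le> cmod (poly (p n) z)"
    by (auto simp: eventually_sequentially)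
  have "eventually (\<lambda>z. \<forall>n\<in>{2..<N}. exp 1 * cmod z \<le> cmod (poly (p n) z)) at_infinity"
    using deg2 by (intro eventually_ball_finite ballI norm_poly_superlinear) auto
  then obtain B where B: "\<forall>z. B \<le> cmod z \<longrightarrow>
      (\<forall>n\<in>{2..<N}. exp 1 * cmod z \<le> cmod (poly (p n) z))"
    unfolding eventually_at_infinity by blast
  show ?thesis
  proof (intro exI[of _ "max \<rho> B"] conjI allI impI)
    show "0 < max \<rho> B"
      using \<rho> by simp
    fix n :: nat and z assume "2 \<le> n" "max \<rho> B \<le> cmod z"
    then show "exp 1 * cmod z \<le> cmod (poly (p n) z)"
      by (cases "n < N") (use N B in auto)
  qed
qed

end
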